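(* Suppose that the coefficients $a_n$ are real. Then there exist $T_0,U_0,\nu>0$ such that for every integer $N\ge2$ and every non-zero $a\in\mathbb{C}$, all $a$-values of $\zeta_N(s)$ on the critical line $\sigma=\delta/2$ with $t\ge T_0$ are simple. Moreover, for $T\ge T_0$ and $U\ge U_0N^{\nu}$, $$N_{a,0}(T,U)=O(U\log N),$$ where the implied constant is independent of $a$ (and of $N,T,U$).
   Context: Write $s=\sigma+it$ with $\sigma,t\in\mathbb{R}$. Let $F(s)=\sum_{n=1}^\infty a_n\lambda_n^{-s}$ be a general Dirichlet series, absolutely convergent in some half-plane, with $a_n\in\mathbb{C}$, $\lambda_n$ real and strictly increasing, $\lambda_1=1$ (so $\lambda_n\ge1$), $a_2\neq0$, $a_3\ne0$ (possibly $a_1=0$), and $|a_n|$, $\lambda_n$ growing at most polynomially in $n$. Assume $F$ satisfies the functional equation $$\Omega(s)F(s)=\lambda^{2s-\delta}\Omega(\delta-s)F(\delta-s),\qquad \Omega(s)=\prod_{i=1}^k\Gamma(\alpha_is+\beta_i),$$ with $\lambda>0$, $\delta\in\mathbb{R}$, $\alpha_i>0$, $\beta_i\in\mathbb{R}$. Put $$F_N(s)=\sum_{n=1}^N\frac{a_n}{\lambda_n^s},\qquad G(s)=\lambda^{2s-\delta}\frac{\Omega(\delta-s)}{\Omega(s)},\qquad \zeta_N(s)=F_N(s)+G(s)F_N(\delta-s).$$ The critical line is $\sigma=\delta/2$. An $a$-value of $\zeta_N$ is a zero of $\zeta_N(s)-a$, counted with multiplicity; it is simple if it is a simple zero of $\zeta_N(s)-a$.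 $N_{a,0}(T,U)$ is the number of $a$-values of $\zeta_N$ on the critical line with $T<t<T+U$. It is always assumed that $T,U$ are such that the endpoints $\delta/2+iT$ and $\delta/2+i(T+U)$ are not $a$-values. *)

theory Defs
  imports "HOL-Complex_Analysis.Complex_Analysis" "HOL-Library.Landau_Symbols"
begin

text \<open>
  Sequences are indexed by \<open>n \<ge> 1\<close> and Gamma factors by \<open>i = 1..k\<close>; values at index 0 are
  irrelevant. The scalar in the conductor factor of the functional equation is called \<open>\<mu>\<close>,
  the frequencies of the Dirichlet series are \<open>lam n\<close>.
\<close>

definition Omega :: "nat \<Rightarrow> (nat \<Rightarrow> real) \<Rightarrow> (nat \<Rightarrow> real) \<Rightarrow> complex \<Rightarrow> complex" where
  "Omega k \<alpha> \<beta> s = (\<Prod>i=1..k. Gamma (of_real (\<alpha> i) * s + of_real (\<beta> i)))"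

text \<open>
  \<open>F\<close> is the meromorphic continuation of the series, and the functional equation is an identity
  of meromorphic functions: it is required off a set without limit points, since \<open>F\<close> and
  \<^const>\<open>Gamma\<close> have no meaningful values at their poles. There is at least one Gamma factor.
\<close>

definition dirichlet_with_functional_equation ::
  "(nat \<Rightarrow> complex) \<Rightarrow> (nat \<Rightarrow> real) \<Rightarrow> nat \<Rightarrow> (nat \<Rightarrow> real) \<Rightarrow> (nat \<Rightarrow> real) \<Rightarrow> real \<Rightarrow> real
    \<Rightarrow> (complex \<Rightarrow> complex) \<Rightarrow> bool" where
  "dirichlet_with_functional_equation a lam k \<alpha> \<beta> \<mu> \<delta> F \<longleftrightarrow>
     strict_mono_on {1..} lam \<and> lam 1 = 1 \<and> a 2 \<noteq> 0 \<and> a 3 \<noteq> 0 \<and>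
     (\<exists>A. (\<lambda>n. norm (a n)) \<in> O(\<lambda>n. real n powr A)) \<and>
     (\<exists>A. lam \<in> O(\<lambda>n. real n powr A)) \<and>
     (\<exists>\<sigma>\<^sub>0. \<forall>s. Re s > \<sigma>\<^sub>0 \<longrightarrow>
        (\<lambda>n. norm (a n / of_real (lam n) powr s)) summable_on {1..} \<and>
        ((\<lambda>n. a n / of_real (lam n) powr s) has_sum F s) {1..}) \<and>
     F meromorphic_on UNIV \<and>
     k \<ge> 1 \<and> (\<forall>i\<in>{1..k}. \<alpha> i > 0) \<and> \<mu> > 0 \<and>
     eventually (\<lambda>s. Omega k \<alpha> \<beta> s * F s =
        of_real \<mu> powr (2 * s - of_real \<delta>) * Omega k \<alpha> \<beta> (of_real \<delta> - s) * F (of_real \<delta> - s))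
       (cosparse UNIV)"

definition partial_F :: "(nat \<Rightarrow> complex) \<Rightarrow> (nat \<Rightarrow> real) \<Rightarrow> nat \<Rightarrow> complex \<Rightarrow> complex" where
  "partial_F a lam N s = (\<Sum>n=1..N. a n / of_real (lam n) powr s)"

text \<open>The poles of the numerator and of the denominator of \<open>G\<close> are all real.\<close>

definition G_factor ::
  "nat \<Rightarrow> (nat \<Rightarrow> real) \<Rightarrow> (nat \<Rightarrow> real) \<Rightarrow> real \<Rightarrow> real \<Rightarrow> complex \<Rightarrow> complex" where
  "G_factor k \<alpha> \<beta> \<mu> \<delta> s =
     of_real \<mu> powr (2 * s - of_real \<delta>) * (Omega k \<alpha> \<beta> (of_real \<delta> - s) / Omega k \<alpha> \<beta> s)"

definition zeta_N ::
  "(nat \<Rightarrow> complex) \<Rightarrow> (nat \<Rightarrow> real) \<Rightarrow> nat \<Rightarrow> (nat \<Rightarrow> real) \<Rightarrow> (nat \<Rightarrow> real) \<Rightarrow> real \<Rightarrow> real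
    \<Rightarrow> nat \<Rightarrow> complex \<Rightarrow> complex" where
  "zeta_N a lam k \<alpha> \<beta> \<mu> \<delta> N s =
     partial_F a lam N s + G_factor k \<alpha> \<beta> \<mu> \<delta> s * partial_F a lam N (of_real \<delta> - s)"

definition value_multiplicity :: "(complex \<Rightarrow> complex) \<Rightarrow> complex \<Rightarrow> complex \<Rightarrow> nat" where
  "value_multiplicity f c s = nat (zorder (\<lambda>z. f z - c) s)"

definition simple_value :: "(complex \<Rightarrow> complex) \<Rightarrow> complex \<Rightarrow> complex \<Rightarrow> bool" where
  "simple_value f c s \<longleftrightarrow> f s = c \<and> value_multiplicity f c s = 1"

definition critical_values ::
  "(complex \<Rightarrow> complex) \<Rightarrow> real \<Rightarrow> complex \<Rightarrow> real \<Rightarrow> real \<Rightarrow> complex set" where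
  "critical_values f \<delta> c T U = {s. Re s = \<delta> / 2 \<and> T < Im s \<and> Im s < T + U \<and> f s = c}"

text \<open>Only meaningful when \<^const>\<open>critical_values\<close> is finite (the sum over an infinite set is 0).\<close>

definition critical_value_count ::
  "(complex \<Rightarrow> complex) \<Rightarrow> real \<Rightarrow> complex \<Rightarrow> real \<Rightarrow> real \<Rightarrow> nat" where
  "critical_value_count f \<delta> c T U = (\<Sum>s\<in>critical_values f \<delta> c T U. value_multiplicity f c s)"

end

theory Submission
  imports Defs
begin

text \<open>
  On the critical line \<open>\<delta> - s\<close> is the conjugate of \<open>s\<close>, so \<open>G\<close> is unimodular there and
  \<open>\<zeta>\<^sub>N(s) = F\<^sub>N(s) + G(s) cnj F\<^sub>N(s)\<close>. The logarithmic derivative of \<open>G\<close> is real on the line, and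
  by the growth of the real part of the digamma function it tends to \<open>-\<infinity>\<close>. If \<open>\<zeta>\<^sub>N(s) = c\<close> and
  \<open>\<zeta>\<^sub>N'(s) = 0\<close>, adding \<open>\<zeta>\<^sub>N'(s)\<close> to \<open>G(s)\<close> times its conjugate gives \<open>(G'/G)(s) c = 0\<close>, which is
  impossible high up on the line when \<open>c \<noteq> 0\<close>.

  For the count, \<open>\<zeta>\<^sub>N(s) = c\<close> on the line forces \<open>G(s) = c / cnj c\<close>. Hence all \<open>c\<close>-values there are
  zeros of \<open>F\<^sub>N(s) + (c / cnj c) F\<^sub>N(\<delta> - s) - c\<close>, an exponential sum with \<open>2N + 1\<close> terms and
  exponents of size at most \<open>ln \<lambda>\<^sub>N\<close>. A zero bound in the style of Tijdeman, which depends neither on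
  the coefficients nor on the gaps between the exponents, gives \<open>O(N + U ln \<lambda>\<^sub>N)\<close> zeros.
\<close>

section \<open>Zeros of exponential sums\<close>

text \<open>In the next lemmas \<open>g (Suc k) = (D - w k) (g k)\<close>, where \<open>D\<close> is differentiation: these operators
  annihilate an exponential sum with exponents \<open>w 0, \<dots>, w (m - 1)\<close>. Cauchy's estimate on \<open>m\<close> discs
  whose radii shrink by \<open>R / m\<close> at each step bounds the whole chain at the centre.\<close>

lemma chain_bound_on_smaller_disc:
  fixes g :: "nat \<Rightarrow> complex \<Rightarrow> complex" and w :: "nat \<Rightarrow> complex"
  assumes der: "\<And>k z. (g k has_field_derivative (g (Suc k) z + w k * g k z)) (at z)"
    and w: "\<And>k. k < m \<Longrightarrow> norm (w k) \<le> \<Delta>"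
    and R: "R > 0" and m: "m > 0" and M: "\<And>z. norm z \<le> R \<Longrightarrow> norm (g 0 z) \<le> M"
    and k: "k \<le> m" and z: "norm z \<le> R - k * R / m"
  shows "norm (g k z) \<le> M * (m / R + \<Delta>) ^ k"
  using k z
proof (induction k arbitrary: z)
  case 0
  then show ?case using M by simp
next
  case (Suc k)
  let ?B = "M * (m / R + \<Delta>) ^ k"
  have rad: "R - real (Suc k) * R / m = R - k * R / m - R / m"
    by (simp add: ring_distribs add_divide_distrib)
  have hol: "g k holomorphic_on UNIV"
    using der by (auto simp: holomorphic_on_def field_differentiable_def)
  \<comment> \<open>The circle of radius \<open>R / m\<close> about \<open>z\<close> stays inside
    the disc of the previous step, so Cauchy's estimate costs a factor \<open>m / R\<close>.
    Removing \<open>w k * g k z\<close> from the derivative then costs a further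
    \<open>\<Delta>\<close>.\<close>
  have "norm ((deriv ^^ 1) (g k) z) \<le> fact 1 * ?B / (R / m) ^ 1"
  proof (rule Cauchy_inequality)
    show "g k holomorphic_on ball z (R / m)" using hol holomorphic_on_subset by blast
    show "continuous_on (cball z (R / m)) (g k)"
      using hol holomorphic_on_imp_continuous_on continuous_on_subset by blast
    show "0 < R / m" using R m by simp
    fix x assume x: "norm (z - x) = R / m"
    have "norm x \<le> norm z + norm (z - x)" by (metis norm_triangle_sub norm_minus_commute)
    then have "norm x \<le> R - k * R / m" using Suc.prems x rad by linarith
    then show "norm (g k x) \<le> ?B" using Suc by simp
  qed
  moreover have "deriv (g k) z = g (Suc k) z + w k * g k z"
    using der by (rule DERIV_imp_deriv)
  ultimately have 1: "norm (g (Suc k) z + w k * g k z) \<le> ?B * (m / R)"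
    by simp
  have "R / m > 0" using R m by simp
  then have "norm z \<le> R - k * R / m" using Suc.prems rad by linarith
  then have 2: "norm (g k z) \<le> ?B" using Suc by simp
  have "norm (w k * g k z) \<le> \<Delta> * ?B"
    unfolding norm_mult using w[of k] Suc.prems 2 by (intro mult_mono) (auto intro: order_trans[OF norm_ge_zero])
  moreover have "norm (g (Suc k) z) \<le> norm (g (Suc k) z + w k * g k z) + norm (w k * g k z)"
    by (metis add_diff_cancel_right' norm_triangle_ineq4)
  ultimately have "norm (g (Suc k) z) \<le> ?B * (m / R) + \<Delta> * ?B" using 1 by linarith
  then show ?case by (simp add: algebra_simps)
qed

text \<open>Variation of constants, from \<open>g m = 0\<close> downwards.\<close>

lemma chain_growth_bound:
  fixes g :: "nat \<Rightarrow> complex \<Rightarrow> complex" and w :: "nat \<Rightarrow> complex"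
  assumes der: "\<And>k z. (g k has_field_derivative (g (Suc k) z + w k * g k z)) (at z)"
    and w: "\<And>k. k < m \<Longrightarrow> norm (w k) \<le> \<Delta>"
    and last: "\<And>z. g m z = 0"
    and A: "A \<ge> 0" and M: "M \<ge> 0"
    and init: "\<And>k. k < m \<Longrightarrow> norm (g k 0) \<le> M * A ^ k"
    and k: "k \<le> m"
  shows "norm (g k z) \<le> M * A ^ k * exp ((A + \<Delta>) * norm z)"
  using k
proof (induction arbitrary: z rule: inc_induct)
  case base
  then show ?case using last A M by simp
next
  case (step k)
  \<comment> \<open>\<open>h\<close> runs along the segment from 0 to \<open>z\<close>, from
    \<open>exp (w k * z) * g k 0\<close> to \<open>g k z\<close>. The exponential is an integrating
    factor: in \<open>h'\<close> the terms with \<open>w k\<close> cancel and only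
    \<open>g (Suc k)\<close> is left. The majorant \<open>\<phi>\<close> dominates \<open>h\<close>
    at 0, its derivative dominates \<open>h'\<close>, and \<open>\<phi> 1\<close> is the bound
    claimed.\<close>
  define h where "h r = exp (w k * (of_real (1 - r) * z)) * g k (of_real r * z)" for r :: real
  define \<phi> where "\<phi> r = exp (\<Delta> * norm z) * M * A ^ k * exp (A * (r * norm z))" for r :: real
  have dh: "(h has_vector_derivative exp (w k * (of_real (1 - r) * z)) * g (Suc k) (of_real r * z) * z) (at r within X)" for r X
  proof -
    have "((\<lambda>r. exp (w k * ((1 - r) * z)) * g k (r * z)) has_field_derivative
       exp (w k * ((1 - of_real r) * z)) * g (Suc k) (of_real r * z) * z) (at (of_real r))"
      by (rule derivative_eq_intros DERIV_chain2[OF der] refl)+ (simp add: algebra_simps)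
    from has_vector_derivative_real_field[OF this]
    have "(h has_vector_derivative exp (w k * ((1 - of_real r) * z)) * g (Suc k) (of_real r * z) * z) (at r within X)"
      unfolding h_def of_real_diff of_real_1 .
    then show ?thesis by simp
  qed
  have dp: "(\<phi> has_vector_derivative exp (\<Delta> * norm z) * M * A ^ Suc k * exp (A * (r * norm z)) * norm z) (at r within X)" for r X
    unfolding \<phi>_def has_real_derivative_iff_has_vector_derivative[symmetric]
    by (rule derivative_eq_intros refl)+ (simp add: algebra_simps)
  have "norm (h 1 - h 0) \<le> \<phi> 1 - \<phi> 0"
  proof (rule differentiable_bound_general)
    show "continuous_on {0..1} h" 
      by (rule continuous_on_vector_derivative) (rule dh)
    show "continuous_on {0..1} \<phi>" 
      by (rule continuous_on_vector_derivative) (rule dp)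
    fix r :: real assume r: "0 < r" "r < 1"
    show "(h has_vector_derivative exp (w k * (of_real (1 - r) * z)) * g (Suc k) (of_real r * z) * z) (at r)" by (rule dh)
    show "(\<phi> has_vector_derivative exp (\<Delta> * norm z) * M * A ^ Suc k * exp (A * (r * norm z)) * norm z) (at r)"
      by (rule dp)
    have "norm (exp (w k * (of_real (1 - r) * z))) \<le> exp (norm (w k * (of_real (1 - r) * z)))"
      by (rule norm_exp)
    also have "\<dots> \<le> exp (\<Delta> * ((1 - r) * norm z))"
      unfolding norm_mult norm_of_real using r w[OF \<open>k < m\<close>] by (auto simp: norm_mult intro!: mult_right_mono)
    finally have 1: "norm (exp (w k * (of_real (1 - r) * z))) \<le> exp (\<Delta> * ((1 - r) * norm z))" .
    have 2: "norm (g (Suc k) (of_real r * z)) \<le> M * A ^ Suc k * exp ((A + \<Delta>) * (r * norm z))"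
      using step.IH[of "of_real r * z"] r by (simp add: norm_mult)
    have "norm (exp (w k * (of_real (1 - r) * z)) * g (Suc k) (of_real r * z) * z)
      \<le> exp (\<Delta> * ((1 - r) * norm z)) * (M * A ^ Suc k * exp ((A + \<Delta>) * (r * norm z))) * norm z"
      unfolding norm_mult[of _ z] norm_mult[of "exp _"]
      by (intro mult_right_mono mult_mono 1 2) auto
    also have "\<dots> = M * A ^ Suc k * norm z * (exp (\<Delta> * ((1 - r) * norm z)) * exp ((A + \<Delta>) * (r * norm z)))"
      by (simp add: mult_ac)
    also have "\<dots> = M * A ^ Suc k * norm z * (exp (\<Delta> * norm z) * exp (A * (r * norm z)))"
      unfolding exp_add[symmetric] by (simp add: algebra_simps)
    finally show "norm (exp (w k * (of_real (1 - r) * z)) * g (Suc k) (of_real r * z) * z)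
       \<le> exp (\<Delta> * norm z) * M * A ^ Suc k * exp (A * (r * norm z)) * norm z"
      by (simp add: mult_ac)
  qed simp
  moreover have "norm (h 0) \<le> \<phi> 0"
  proof -
    have "norm (exp (w k * z)) \<le> exp (\<Delta> * norm z)"
      using w[OF \<open>k < m\<close>] by (intro order_trans[OF norm_exp]) (auto simp: norm_mult intro!: mult_right_mono)
    then have "norm (exp (w k * z) * g k 0) \<le> exp (\<Delta> * norm z) * (M * A ^ k)"
      unfolding norm_mult using init[OF \<open>k < m\<close>] by (intro mult_mono) auto
    then show ?thesis by (simp add: h_def \<phi>_def mult_ac)
  qed
  ultimately have "norm (h 1) \<le> \<phi> 1"
    using norm_triangle_sub[of "h 1" "h 0"] by linarith
  then show ?case by (simp add: h_def \<phi>_def algebra_simps flip: exp_add)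
qed

section \<open>Counting zeros by comparing growth on two concentric discs\<close>

text \<open>Each zero \<open>s\<close> is divided out in turn. On the circle of radius
  \<open>7 * R\<close> the factor \<open>z - s\<close> has norm at least \<open>6 * R\<close>, while
  at \<open>u\<close> it has norm at most \<open>2 * R\<close>, so each zero gains a factor
  3.\<close>

lemma norm_le_of_zeros_in_disc:
  fixes f :: "complex \<Rightarrow> complex"
  assumes "finite Z" "f holomorphic_on UNIV" "\<And>z. z \<in> Z \<Longrightarrow> norm z \<le> R \<and> f z = 0"
    and "R > 0" "\<And>z. norm z = 7 * R \<Longrightarrow> norm (f z) \<le> B" "norm u \<le> R"
  shows "3 ^ card Z * norm (f u) \<le> B"
  using assms
proof (induction Z arbitrary: f B rule: finite_induct)
  case empty
  have "norm (f u) \<le> B"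
  proof (rule maximum_modulus_frontier[of f "cball 0 (7 * R)"])
    show "f holomorphic_on interior (cball 0 (7 * R))" "continuous_on (closure (cball 0 (7 * R))) f"
      using empty holomorphic_on_subset holomorphic_on_imp_continuous_on by blast+
  qed (use empty in auto)
  then show ?case by simp
next
  case (insert s Z)
  \<comment> \<open>The value at \<open>s\<close> fills in the removable singularity, so
    \<open>q\<close> is again entire. The remaining points of \<open>Z\<close> differ from
    \<open>s\<close> and stay zeros of \<open>q\<close>.\<close>
  define q where "q = (\<lambda>z. if z = s then deriv f s else (f z - f s) / (z - s))"
  have q: "q holomorphic_on UNIV"
    unfolding q_def using insert.prems by (intro pole_lemma) auto
  have s: "norm s \<le> R" "f s = 0" using insert.prems by auto
  have fq: "f z = (z - s) * q z" for z
    using s by (simp add: q_def)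
  have "3 ^ card Z * norm (q u) \<le> B / (6 * R)"
  proof (rule insert.IH[OF q])
    fix z assume "z \<in> Z"
    then show "norm z \<le> R \<and> q z = 0"
      using insert.prems(2)[of z] insert.hyps s by (auto simp: q_def)
  next
    fix z :: complex assume z: "norm z = 7 * R"
    have "6 * R \<le> norm (z - s)" using norm_triangle_ineq2[of z s] z s by linarith
    then have "6 * R * norm (q z) \<le> norm (z - s) * norm (q z)" by (intro mult_right_mono) auto
    also have "\<dots> \<le> B" using insert.prems(4)[OF z] by (simp add: fq norm_mult)
    finally show "norm (q z) \<le> B / (6 * R)" using \<open>R > 0\<close> by (simp add: field_simps)
  qed (use insert.prems in auto)
  then have 1: "6 * R * (3 ^ card Z * norm (q u)) \<le> B"
    using \<open>R > 0\<close> by (simp add: field_simps)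
  have "norm (u - s) \<le> 2 * R" using norm_triangle_ineq4[of u s] s insert.prems by linarith
  then have "3 ^ Suc (card Z) * (norm (u - s) * norm (q u)) \<le> 3 ^ Suc (card Z) * (2 * R * norm (q u))"
    by (intro mult_left_mono mult_right_mono) auto
  also have "\<dots> \<le> B" using 1 by (simp add: algebra_simps)
  finally show ?case using insert.hyps by (simp add: fq norm_mult)
qed

text \<open>The maximum \<open>M\<close> of \<open>g 0\<close> on the disc of radius
  \<open>R\<close> controls the whole chain at 0, and the chain at 0 controls \<open>g 0\<close> on
  the circle of radius \<open>7 * R\<close>. Both bounds are proportional to \<open>M\<close>, which
  cancels against the value at the maximum point \<open>u\<close>; this is why no coefficient enters
  the result.\<close>

lemma chain_zeros_card_le:
  fixes g :: "nat \<Rightarrow> complex \<Rightarrow> complex" and w :: "nat \<Rightarrow> complex"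
  assumes der: "\<And>k z. (g k has_field_derivative (g (Suc k) z + w k * g k z)) (at z)"
    and w: "\<And>k. k < m \<Longrightarrow> norm (w k) \<le> \<Delta>"
    and R: "R > 0" and m: "m > 0" and last: "\<And>z. g m z = 0"
    and nz: "g (m - 1) 0 \<noteq> 0"
    and Z: "finite Z" "\<And>z. z \<in> Z \<Longrightarrow> norm z \<le> R \<and> g 0 z = 0"
  shows "real (card Z) \<le> 7 * real m + 14 * R * \<Delta>"
proof -
  have hol: "g 0 holomorphic_on UNIV"
    using der by (auto simp: holomorphic_on_def field_differentiable_def)
  have "continuous_on (cball 0 R) (\<lambda>z. norm (g 0 z))"
    using hol holomorphic_on_imp_continuous_on continuous_on_subset 
    by (intro continuous_on_norm) blast
  then obtain u where u: "norm u \<le> R" "\<And>z. norm z \<le> R \<Longrightarrow> norm (g 0 z) \<le> norm (g 0 u)"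
    using continuous_attains_sup[of "cball 0 R" "\<lambda>z. norm (g 0 z)"] R by auto
  define M where "M = norm (g 0 u)"
  define A where "A = m / R + \<Delta>"
  have \<Delta>: "\<Delta> \<ge> 0" using w[of 0] m norm_ge_zero order_trans by blast
  have A: "A \<ge> 0" using R \<Delta> by (simp add: A_def)
  have init: "norm (g k 0) \<le> M * A ^ k" if "k \<le> m" for k
    unfolding A_def
  proof (rule chain_bound_on_smaller_disc[where g = g and w = w and m = m and R = R])
    show "norm (0::complex) \<le> R - k * R / m" using that R m by (simp add: field_simps)
  qed (use der w R m u that in \<open>auto simp: M_def\<close>)
  \<comment> \<open>If \<open>M\<close> were 0, the chain would vanish at 0, against the assumption
    on \<open>g (m - 1) 0\<close>.\<close>
  have "M > 0"
  proof (rule ccontr)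
    assume "\<not> M > 0"
    then have "M = 0" by (simp add: M_def)
    then show False using init[of "m - 1"] nz by simp
  qed
  have "3 ^ card Z * norm (g 0 u) \<le> M * exp ((A + \<Delta>) * (7 * R))"
  proof (rule norm_le_of_zeros_in_disc[OF Z(1) hol Z(2) R])
    fix z :: complex assume "norm z = 7 * R"
    then show "norm (g 0 z) \<le> M * exp ((A + \<Delta>) * (7 * R))"
      using chain_growth_bound[of g w m \<Delta> A M 0 z] der w last A \<open>M > 0\<close> init by simp
  qed (use u in auto)
  then have "3 ^ card Z \<le> exp ((A + \<Delta>) * (7 * R))"
    using \<open>M > 0\<close> by (simp add: M_def[symmetric] mult.commute)
  \<comment> \<open>Since \<open>exp 1 \<le> 3\<close>, the logarithm of the power of 3 is at least
    the number of zeros. The exponent \<open>(A + \<Delta>) * (7 * R)\<close> then expands to the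
    stated bound.\<close>
  moreover have "exp (real (card Z)) \<le> 3 ^ card Z"
    using power_mono[OF exp_le, of "card Z"] by (simp add: exp_of_nat_mult[symmetric])
  ultimately have "real (card Z) \<le> (A + \<Delta>) * (7 * R)"
    using order_trans exp_le_cancel_iff by blast
  also have "\<dots> = 7 * real m + 14 * R * \<Delta>" using R by (simp add: A_def field_simps)
  finally show ?thesis by simp
qed

text \<open>Translating the disc to the origin multiplies each coefficient by a nonzero constant;
  \<open>p\<close> is put last in the enumeration, so that the last member of the chain does not vanish.\<close>

proposition exponential_sum_zeros_card_le:
  fixes b w :: "'a \<Rightarrow> complex"
  assumes S: "finite S" and p: "p \<in> S" "b p \<noteq> 0" "\<And>j. j \<in> S \<Longrightarrow> j \<noteq> p \<Longrightarrow> w j \<noteq> w p"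
    and w: "\<And>j. j \<in> S \<Longrightarrow> norm (w j) \<le> \<Delta>" and R: "R > 0"
    and Z: "\<And>s. s \<in> Z \<Longrightarrow> dist s s0 \<le> R \<and> (\<Sum>j\<in>S. b j * exp (w j * s)) = 0"
  shows "finite Z \<and> real (card Z) \<le> 7 * real (card S) + 14 * R * \<Delta>"
proof -
  define m where "m = card S"
  have m: "m > 0" using S p by (auto simp: m_def card_gt_0_iff)
  obtain e0 where e0: "bij_betw e0 {0..<m - 1} (S - {p})"
    using ex_bij_betw_nat_finite[of "S - {p}"] S p by (auto simp: m_def)
  define e where "e = e0(m - 1 := p)"
  have "bij_betw e {0..<m - 1} (S - {p})"
    using e0 by (subst bij_betw_cong[where g = e0]) (auto simp: e_def)
  then have "bij_betw e ({0..<m - 1} \<union> {m - 1}) ((S - {p}) \<union> {e (m - 1)})"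
    by (intro notIn_Un_bij_betw) (auto simp: e_def)
  moreover have "{0..<m - 1} \<union> {m - 1} = {..<m}" using m by auto
  moreover have em: "e (m - 1) = p" by (simp add: e_def)
  moreover have "(S - {p}) \<union> {p} = S" using p by auto
  ultimately have e: "bij_betw e {..<m} S" by simp
  have eS: "e j \<in> S" if "j < m" for j using e that by (auto simp: bij_betw_def)
  \<comment> \<open>Applying \<open>D - w (e k)\<close> multiplies the \<open>j\<close>-th term by
    \<open>w (e j) - w (e k)\<close>. Hence every term of \<open>g m\<close> has a zero factor, and
    at stage \<open>m - 1\<close> only the term of \<open>p\<close> survives. The exponents other
    than \<open>w p\<close> may coincide with each other.\<close>
  define g where "g k z = (\<Sum>j<m. (b (e j) * exp (w (e j) * s0)) * (\<Prod>i<k. w (e j) - w (e i)) * exp (w (e j) * z))"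
    for k :: nat and z
  have g0: "g 0 z = (\<Sum>j\<in>S. b j * exp (w j * (s0 + z)))" for z
    unfolding g_def sum.reindex_bij_betw[OF e, symmetric]
    by (simp add: ring_distribs exp_add mult_ac)
  have der: "(g k has_field_derivative (g (Suc k) z + w (e k) * g k z)) (at z)" for k z
    unfolding g_def
    by (rule derivative_eq_intros refl)+
       (simp add: sum_distrib_left sum.distrib[symmetric] algebra_simps)
  have gm: "g m z = 0" for z
    unfolding g_def by (rule sum.neutral) (auto simp: prod_zero_iff)
  have "g (m - 1) 0 = (\<Sum>j\<in>{m - 1}. (b (e j) * exp (w (e j) * s0)) * (\<Prod>i<m - 1. w (e j) - w (e i)) * exp (w (e j) * 0))"
    unfolding g_def using m by (intro sum.mono_neutral_right) (auto simp: prod_zero_iff)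
  moreover have "w p \<noteq> w (e i)" if "i < m - 1" for i
  proof -
    have "e i \<in> S - {p}" using that e0 by (auto simp: e_def bij_betw_def)
    then show ?thesis using p(3)[of "e i"] by auto
  qed
  ultimately have nz: "g (m - 1) 0 \<noteq> 0" using p em by (simp add: prod_zero_iff)
  \<comment> \<open>\<open>Z\<close> is not yet known to be finite, so the bound is proved for its
    finite subsets first; its uniformity then gives finiteness of \<open>Z\<close>.\<close>
  have bound: "real (card G) \<le> 7 * real m + 14 * R * \<Delta>" if G: "G \<subseteq> Z" "finite G" for G
  proof -
    have "real (card ((\<lambda>s. s - s0) ` G)) \<le> 7 * real m + 14 * R * \<Delta>"
    proof (rule chain_zeros_card_le[of g "\<lambda>k. w (e k)"])
      fix z assume "z \<in> (\<lambda>s. s - s0) ` G"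
      then show "norm z \<le> R \<and> g 0 z = 0" using Z G by (auto simp: g0 dist_norm)
    qed (use der gm nz m R w eS G in auto)
    moreover have "inj_on (\<lambda>s. s - s0) G" by (auto simp: inj_on_def)
    ultimately show ?thesis by (simp add: card_image)
  qed
  have "finite Z \<and> card Z \<le> nat \<lfloor>7 * real m + 14 * R * \<Delta>\<rfloor>"
    by (rule finite_if_finite_subsets_card_bdd, rule le_nat_floor, rule bound)
  then show ?thesis using bound[of Z] by (simp add: m_def)
qed

section \<open>The Gamma factors on the critical line\<close>

lemma cnj_Digamma:
  assumes "z \<noteq> 0"
  shows "cnj (Digamma z) = Digamma (cnj z)"
proof (rule LIMSEQ_unique)
  show "(\<lambda>m. cnj (of_real (ln (real m)) - (\<Sum>n<m. inverse (z + of_nat n)))) \<longlonglongrightarrow> cnj (Digamma z)"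
    by (intro tendsto_cnj Digamma_LIMSEQ assms)
  show "(\<lambda>m. cnj (of_real (ln (real m)) - (\<Sum>n<m. inverse (z + of_nat n)))) \<longlonglongrightarrow> Digamma (cnj z)"
    using Digamma_LIMSEQ[of "cnj z"] assms by simp
qed

lemma Re_inverse_le: "Im z \<noteq> 0 \<Longrightarrow> Re (inverse z) \<le> 1 / \<bar>Im z\<bar>"
proof -
  assume z: "Im z \<noteq> 0"
  have "Re (inverse z) \<le> norm (inverse z)" by (rule complex_Re_le_cmod)
  also have "\<dots> \<le> 1 / \<bar>Im z\<bar>"
    using z abs_Im_le_cmod[of z] by (auto simp: norm_inverse divide_inverse intro!: le_imp_inverse_le)
  finally show ?thesis .
qed

text \<open>In the limit formula for \<open>Digamma\<close>, the first \<open>K\<close> summands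
  have real part at most \<open>1 / \<bar>Im z\<bar>\<close>, and the others are compared with the
  harmonic series. As \<open>K\<close> is free, the bound can be made large once \<open>Im z\<close>
  is large.\<close>

lemma Re_Digamma_ge:
  assumes z: "Re z \<ge> 1" "Im z \<noteq> 0"
  shows "Re (Digamma z) \<ge> harm K - euler_mascheroni - K / \<bar>Im z\<bar>"
proof -
  have *: "Re (inverse (z + of_nat n)) \<le> inverse (real (Suc n))" for n
  proof -
    have "Re (inverse u) \<le> inverse (Re u)" if "Re u > 0" for u
    proof -
      have "Re (inverse u) = Re u / ((Re u)\<^sup>2 + (Im u)\<^sup>2)" by simp
      also have "\<dots> \<le> Re u / (Re u)\<^sup>2" using that by (intro divide_left_mono) (auto intro!: mult_pos_pos add_pos_nonneg)
      also have "\<dots> = inverse (Re u)" using that by (simp add: power2_eq_square divide_inverse)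
      finally show ?thesis .
    qed
    from this[of "z + of_nat n"] have "Re (inverse (z + of_nat n)) \<le> inverse (Re (z + of_nat n))"
      using z by (simp del: inverse_complex.simps)
    also have "\<dots> \<le> inverse (real (Suc n))" using z by (intro le_imp_inverse_le) auto
    finally show ?thesis .
  qed
  have lim: "(\<lambda>m. ln (real m) - (\<Sum>n<m. Re (inverse (z + of_nat n)))) \<longlonglongrightarrow> Re (Digamma z)"
  proof -
    have "z \<noteq> 0" using z by auto
    from tendsto_Re[OF Digamma_LIMSEQ[OF this]] show ?thesis by simp
  qed
  \<comment> \<open>The lower bound is arranged so that its only part depending on \<open>m\<close>
    is \<open>harm m - ln (real m)\<close>, which tends to the Euler-Mascheroni constant.\<close>
  have lim': "(\<lambda>m. harm K - (harm m - ln (real m)) - K / \<bar>Im z\<bar>) \<longlonglongrightarrow> harm K - euler_mascheroni - K / \<bar>Im z\<bar>"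
    by (intro tendsto_intros euler_mascheroni_LIMSEQ)
  have "harm K - (harm m - ln (real m)) - K / \<bar>Im z\<bar> \<le> ln (real m) - (\<Sum>n<m. Re (inverse (z + of_nat n)))"
    if "m \<ge> K" for m
  proof -
    have split: "(\<Sum>n<m. f n) = (\<Sum>n<K. f n) + (\<Sum>n\<in>{K..<m}. f n)" for f :: "nat \<Rightarrow> real"
      using that by (simp add: lessThan_atLeast0 sum.atLeastLessThan_concat)
    have h: "harm j = (\<Sum>n<j. inverse (real (Suc n)))" for j
      unfolding harm_def by (rule sum.reindex_bij_witness[of _ Suc "\<lambda>i. i - 1"]) auto
    have "(\<Sum>n<K. Re (inverse (z + of_nat n))) \<le> (\<Sum>n<K. 1 / \<bar>Im z\<bar>)"
      using z Re_inverse_le[of "z + of_nat _"] by (intro sum_mono) auto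
    moreover have "(\<Sum>n\<in>{K..<m}. Re (inverse (z + of_nat n))) \<le> (\<Sum>n\<in>{K..<m}. inverse (real (Suc n)))"
      by (intro sum_mono *)
    ultimately show ?thesis unfolding h split[of "\<lambda>n. Re (inverse (z + of_nat n))"] split[of "\<lambda>n. inverse (real (Suc n))"]
      by simp
  qed
  then show ?thesis
    by (intro LIMSEQ_le[OF lim' lim]) auto
qed

text \<open>For \<open>x \<ge> 1\<close> the previous bound applies with \<open>K\<close> fixed.
  Smaller \<open>x\<close> are reached by unit shifts to the left through the recurrence
  \<open>Digamma (z + 1) = Digamma z + 1 / z\<close>, each losing at most 1 when
  \<open>t \<ge> 1\<close>.\<close>

lemma Re_Digamma_at_top:
  "filterlim (\<lambda>t. Re (Digamma (Complex x t))) at_top at_top"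
proof -
  have "filterlim (\<lambda>t. Re (Digamma (Complex x t))) at_top at_top" if "x \<ge> 1 - real j" for x j
    using that
  proof (induction j arbitrary: x)
    case 0
    show ?case unfolding filterlim_at_top
    proof
      fix Z :: real
      obtain K where K: "harm K \<ge> Z + euler_mascheroni + 1"
        using filterlim_at_top[THEN iffD1, OF harm_at_top] eventually_happens by (metis trivial_limit_sequentially)
      show "\<forall>\<^sub>F t in at_top. Z \<le> Re (Digamma (Complex x t))"
        using eventually_ge_at_top[of "max 1 (real K)"]
      proof eventually_elim
        case (elim t)
        then have "real K / \<bar>t\<bar> \<le> 1" by simp
        moreover have "Re (Digamma (Complex x t)) \<ge> harm K - euler_mascheroni - K / \<bar>t\<bar>"
          using Re_Digamma_ge[of "Complex x t" K] 0 elim by simp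
        ultimately show ?case using K by linarith
      qed
    qed
  next
    case (Suc j)
    have "filterlim (\<lambda>t. - 1 + Re (Digamma (Complex (x + 1) t))) at_top at_top"
      using Suc by (intro filterlim_tendsto_add_at_top[OF tendsto_const]) auto
    then show ?case
    proof (rule filterlim_at_top_mono)
      show "\<forall>\<^sub>F t in at_top. - 1 + Re (Digamma (Complex (x + 1) t)) \<le> Re (Digamma (Complex x t))"
        using eventually_ge_at_top[of 1]
      proof eventually_elim
        case (elim t)
        have eq: "Complex (x + 1) t = Complex x t + 1" by (simp add: complex_eq_iff)
        have "Complex x t \<noteq> 0" using elim by (simp add: complex_eq_iff)
        then have "Digamma (Complex (x + 1) t) = Digamma (Complex x t) + 1 / Complex x t"
          unfolding eq by (rule Digamma_plus1)
        moreover have "Re (1 / Complex x t) \<le> 1 / \<bar>t\<bar>"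
          using Re_inverse_le[of "Complex x t"] elim by (simp add: inverse_eq_divide)
        moreover have "1 / \<bar>t\<bar> \<le> 1" using elim by simp
        ultimately show ?case by simp
      qed
    qed
  qed
  moreover have "1 - real (nat \<lceil>1 - x\<rceil>) \<le> x" by linarith
  ultimately show ?thesis by blast
qed

section \<open>The Gamma product and the factor G off the real axis\<close>

lemma not_nonpos_Ints_affine:
  assumes "(\<alpha>::real) > 0" "Im s \<noteq> 0"
  shows "of_real \<alpha> * s + of_real \<beta> \<notin> \<int>\<^sub>\<le>\<^sub>0"
  using assms by (auto elim!: nonpos_Ints_cases simp: complex_eq_iff)

text \<open>\<open>Gamma\<close> has no true zeros, but takes the default value 0 at its poles; off
  the real axis no argument is a pole.\<close>

lemma Omega_nonzero:
  assumes "\<forall>i\<in>{1..k}. \<alpha> i > 0" "Im s \<noteq> 0"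
  shows "Omega k \<alpha> \<beta> s \<noteq> 0"
  unfolding Omega_def using assms not_nonpos_Ints_affine
  by (auto simp: prod_zero_iff Gamma_eq_zero_iff)

lemma cnj_Omega: "cnj (Omega k \<alpha> \<beta> s) = Omega k \<alpha> \<beta> (cnj s)"
  by (simp add: Omega_def cnj_Gamma)

lemma has_field_derivative_Omega:
  assumes "\<forall>i\<in>{1..k}. \<alpha> i > 0" "Im s \<noteq> 0"
  shows "(Omega k \<alpha> \<beta> has_field_derivative Omega k \<alpha> \<beta> s *
           (\<Sum>i=1..k. of_real (\<alpha> i) * Digamma (of_real (\<alpha> i) * s + of_real (\<beta> i)))) (at s)"
proof -
  let ?z = "\<lambda>i. of_real (\<alpha> i) * s + of_real (\<beta> i)"
  have ni: "?z i \<notin> \<int>\<^sub>\<le>\<^sub>0" if "i \<in> {1..k}" for i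
    using not_nonpos_Ints_affine assms that by blast
  have "((\<lambda>s. \<Prod>i=1..k. Gamma (of_real (\<alpha> i) * s + of_real (\<beta> i))) has_field_derivative
      (\<Prod>i=1..k. Gamma (?z i)) * (\<Sum>i=1..k. Gamma (?z i) * Digamma (?z i) * of_real (\<alpha> i) / Gamma (?z i))) (at s)"
    by (rule has_field_derivative_prod')
       (use ni in \<open>auto simp: Gamma_eq_zero_iff intro!: derivative_eq_intros DERIV_chain2[OF has_field_derivative_Gamma]\<close>)
  moreover have "(\<Sum>i=1..k. Gamma (?z i) * Digamma (?z i) * of_real (\<alpha> i) / Gamma (?z i)) =
      (\<Sum>i=1..k. of_real (\<alpha> i) * Digamma (?z i))"
    using ni by (intro sum.cong) (auto simp: Gamma_eq_zero_iff)
  ultimately show ?thesis unfolding Omega_def by simp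
qed

text \<open>This is \<open>G' / G\<close> only on the critical line.\<close>

definition G_log_deriv :: "nat \<Rightarrow> (nat \<Rightarrow> real) \<Rightarrow> (nat \<Rightarrow> real) \<Rightarrow> real \<Rightarrow> complex \<Rightarrow> real" where
  "G_log_deriv k \<alpha> \<beta> \<mu> s =
     2 * ln \<mu> - 2 * (\<Sum>i=1..k. \<alpha> i * Re (Digamma (of_real (\<alpha> i) * s + of_real (\<beta> i))))"

lemma reflect_critical_line: "Re s = \<delta> / 2 \<Longrightarrow> of_real \<delta> - s = cnj s"
  by (simp add: complex_eq_iff)

lemma has_field_derivative_G_factor:
  assumes "\<forall>i\<in>{1..k}. \<alpha> i > 0" "\<mu> > 0" "Im s \<noteq> 0"
  shows "(G_factor k \<alpha> \<beta> \<mu> \<delta> has_field_derivative G_factor k \<alpha> \<beta> \<mu> \<delta> s *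
     (2 * of_real (ln \<mu>) - (\<Sum>i=1..k. of_real (\<alpha> i) * Digamma (of_real (\<alpha> i) * (of_real \<delta> - s) + of_real (\<beta> i)))
       - (\<Sum>i=1..k. of_real (\<alpha> i) * Digamma (of_real (\<alpha> i) * s + of_real (\<beta> i))))) (at s)"
proof -
  have pw: "of_real \<mu> powr w = exp (w * of_real (ln \<mu>))" for w :: complex
    using assms by (simp add: powr_def Ln_of_real)
  have nz: "Omega k \<alpha> \<beta> s \<noteq> 0" using Omega_nonzero[of k \<alpha> s \<beta>] assms by blast
  have im: "Im (of_real \<delta> - s) \<noteq> 0" using assms by simp
  note d1 = has_field_derivative_Omega[OF assms(1) assms(3)]
  have d2: "((\<lambda>z. Omega k \<alpha> \<beta> (of_real \<delta> - z)) has_field_derivative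
      Omega k \<alpha> \<beta> (of_real \<delta> - s) * (\<Sum>i=1..k. of_real (\<alpha> i) *
        Digamma (of_real (\<alpha> i) * (of_real \<delta> - s) + of_real (\<beta> i))) * (0 - 1)) (at s)"
    by (rule DERIV_chain2[where g = "\<lambda>z. of_real \<delta> - z"])
       (rule has_field_derivative_Omega, use assms(1) im in \<open>auto intro!: derivative_eq_intros\<close>)
  show ?thesis
    unfolding G_factor_def[abs_def] pw
    by (rule derivative_eq_intros d1 d2 refl | (simp add: nz; fail))+
       (use nz in \<open>simp add: field_simps power2_eq_square\<close>)
qed

text \<open>On the line the two digamma sums are conjugate to each other, so their sum is twice a
  real part.\<close>

lemma has_field_derivative_G_factor_critical_line:
  assumes "\<forall>i\<in>{1..k}. \<alpha> i > 0" "\<mu> > 0" "Im s \<noteq> 0" and s: "Re s = \<delta> / 2"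
  shows "(G_factor k \<alpha> \<beta> \<mu> \<delta> has_field_derivative
     G_factor k \<alpha> \<beta> \<mu> \<delta> s * of_real (G_log_deriv k \<alpha> \<beta> \<mu> s)) (at s)"
proof -
  have "of_real (\<alpha> i) * Digamma (of_real (\<alpha> i) * cnj s + of_real (\<beta> i)) +
      of_real (\<alpha> i) * Digamma (of_real (\<alpha> i) * s + of_real (\<beta> i)) =
      2 * of_real (\<alpha> i * Re (Digamma (of_real (\<alpha> i) * s + of_real (\<beta> i))))" if "i \<in> {1..k}" for i
  proof -
    let ?u = "of_real (\<alpha> i) * s + of_real (\<beta> i)"
    have "?u \<notin> \<int>\<^sub>\<le>\<^sub>0" using not_nonpos_Ints_affine bspec[OF assms(1) that] assms(3) by blast
    then have "?u \<noteq> 0" by auto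
    from cnj_Digamma[OF this] complex_add_cnj[of "Digamma ?u"]
    have "Digamma (of_real (\<alpha> i) * cnj s + of_real (\<beta> i)) + Digamma ?u = of_real (2 * Re (Digamma ?u))"
      by (simp add: add.commute)
    then show ?thesis by (simp flip: distrib_left)
  qed
  then have "of_real (G_log_deriv k \<alpha> \<beta> \<mu> s) = 2 * of_real (ln \<mu>) -
      (\<Sum>i=1..k. of_real (\<alpha> i) * Digamma (of_real (\<alpha> i) * (of_real \<delta> - s) + of_real (\<beta> i)))
       - (\<Sum>i=1..k. of_real (\<alpha> i) * Digamma (of_real (\<alpha> i) * s + of_real (\<beta> i)))"
    unfolding reflect_critical_line[OF s] diff_diff_eq sum.distrib[symmetric]
    by (simp add: G_log_deriv_def sum_distrib_left)
  then show ?thesis using has_field_derivative_G_factor[of k \<alpha> \<mu> s \<beta> \<delta>] assms by simp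
qed

text \<open>The exponent of \<open>\<mu>\<close> is purely imaginary on the line, and the numerator
  of the Omega quotient is the conjugate of its denominator.\<close>

lemma G_factor_unimodular:
  assumes "\<forall>i\<in>{1..k}. \<alpha> i > 0" "\<mu> > 0" "Im s \<noteq> 0" and s: "Re s = \<delta> / 2"
  shows "G_factor k \<alpha> \<beta> \<mu> \<delta> s * cnj (G_factor k \<alpha> \<beta> \<mu> \<delta> s) = 1"
proof -
  have "2 * s - of_real \<delta> = \<i> * of_real (2 * Im s)"
    using s by (simp add: complex_eq_iff)
  then have "norm (of_real \<mu> powr (2 * s - of_real \<delta>)) = 1"
    using assms(2) by (simp add: powr_def Ln_of_real)
  moreover have "norm (Omega k \<alpha> \<beta> (cnj s) / Omega k \<alpha> \<beta> s) = 1"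
    using Omega_nonzero[of k \<alpha> s \<beta>] assms by (simp add: cnj_Omega[symmetric] norm_divide)
  ultimately have "norm (G_factor k \<alpha> \<beta> \<mu> \<delta> s) = 1"
    by (simp only: G_factor_def reflect_critical_line[OF s] norm_mult mult_1)
  then show ?thesis by (simp add: complex_norm_square[symmetric])
qed

lemma G_log_deriv_eventually_negative:
  assumes "k \<ge> 1" "\<forall>i\<in>{1..k}. \<alpha> i > 0"
  shows "\<forall>\<^sub>F t in at_top. G_log_deriv k \<alpha> \<beta> \<mu> (Complex (\<delta> / 2) t) < 0"
proof -
  define \<psi> where "\<psi> i t = Re (Digamma (of_real (\<alpha> i) * Complex (\<delta> / 2) t + of_real (\<beta> i)))" for i t
  \<comment> \<open>With this threshold each \<open>\<alpha> i * \<psi> i t\<close> is at least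
    \<open>\<bar>ln \<mu>\<bar> + 1\<close>, so a single Gamma factor already outweighs
    \<open>ln \<mu>\<close>.\<close>
  have "\<forall>\<^sub>F t in at_top. \<psi> i t \<ge> (\<bar>ln \<mu>\<bar> + 1) / \<alpha> i" if i: "i \<in> {1..k}" for i
  proof -
    have eq: "of_real (\<alpha> i) * Complex (\<delta> / 2) t + of_real (\<beta> i) = Complex (\<alpha> i * (\<delta> / 2) + \<beta> i) (\<alpha> i * t)" for t
      by (simp add: complex_eq_iff)
    have "filterlim (\<lambda>t. \<alpha> i * t) at_top at_top"
      using bspec[OF assms(2) i] by (intro filterlim_tendsto_pos_mult_at_top[OF tendsto_const] filterlim_ident)
    from filterlim_compose[OF Re_Digamma_at_top this] show ?thesis
      by (simp add: \<psi>_def eq filterlim_at_top)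
  qed
  then have "\<forall>\<^sub>F t in at_top. \<forall>i\<in>{1..k}. \<psi> i t \<ge> (\<bar>ln \<mu>\<bar> + 1) / \<alpha> i"
    by (intro eventually_ball_finite) auto
  then show ?thesis
  proof eventually_elim
    case (elim t)
    have "(\<Sum>i=1..k. \<bar>ln \<mu>\<bar> + 1) \<le> (\<Sum>i=1..k. \<alpha> i * \<psi> i t)"
      using elim assms(2) by (intro sum_mono) (auto simp: field_simps)
    moreover have "1 * (\<bar>ln \<mu>\<bar> + 1) \<le> real k * (\<bar>ln \<mu>\<bar> + 1)"
      using assms(1) by (intro mult_right_mono) auto
    ultimately show ?case by (simp add: G_log_deriv_def \<psi>_def)
  qed
qed

section \<open>Values on the critical line\<close>

lemma frequency_ge_1:
  fixes lam :: "nat \<Rightarrow> real"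
  assumes "strict_mono_on {1..} lam" "lam 1 = 1" "n \<ge> 1"
  shows "lam n \<ge> 1"
  using strict_mono_onD[OF assms(1), of 1 n] assms by (cases "n = 1") auto

lemma partial_F_conv_exp:
  assumes "\<forall>n\<ge>1. lam n > 0"
  shows "partial_F a lam N s = (\<Sum>n=1..N. a n * exp (- of_real (ln (lam n)) * s))"
  unfolding partial_F_def
proof (rule sum.cong)
  fix n assume "n \<in> {1..N}"
  then have "lam n > 0" using assms by simp
  then show "a n / of_real (lam n) powr s = a n * exp (- of_real (ln (lam n)) * s)"
    by (simp add: powr_def Ln_of_real exp_minus divide_inverse mult.commute)
qed simp

lemma cnj_partial_F:
  assumes "\<forall>n\<ge>1. lam n > 0" "\<forall>n\<ge>1. a n \<in> \<real>"
  shows "cnj (partial_F a lam N s) = partial_F a lam N (cnj s)"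
  unfolding partial_F_conv_exp[OF assms(1)] using assms(2)
  by (simp add: exp_cnj Reals_cnj_iff)

text \<open>The derivative is written as another \<open>partial_F\<close>, with real coefficients
  whenever those of \<open>a\<close> are real, so that \<open>cnj_partial_F\<close> applies to it
  too.\<close>

lemma has_field_derivative_partial_F:
  assumes "\<forall>n\<ge>1. lam n > 0"
  shows "(partial_F a lam N has_field_derivative
     partial_F (\<lambda>n. - of_real (ln (lam n)) * a n) lam N s) (at s)"
proof -
  have "((\<lambda>s. \<Sum>n=1..N. a n * exp (- of_real (ln (lam n)) * s)) has_field_derivative
     (\<Sum>n=1..N. - of_real (ln (lam n)) * a n * exp (- of_real (ln (lam n)) * s))) (at s)"
    by (rule derivative_eq_intros refl)+ (simp add: algebra_simps)
  moreover have "partial_F a lam N = (\<lambda>s. \<Sum>n=1..N. a n * exp (- of_real (ln (lam n)) * s))"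
    using partial_F_conv_exp[OF assms] by blast
  ultimately show ?thesis
    by (simp add: partial_F_conv_exp[OF assms])
qed

lemma zeta_N_holomorphic:
  assumes lam: "\<forall>n\<ge>1. lam n > 0" and \<alpha>: "\<forall>i\<in>{1..k}. \<alpha> i > 0" and \<mu>: "\<mu> > 0"
  shows "zeta_N a lam k \<alpha> \<beta> \<mu> \<delta> N holomorphic_on {s. Im s > 0}"
proof -
  have "zeta_N a lam k \<alpha> \<beta> \<mu> \<delta> N field_differentiable (at s)" if "Im s > 0" for s
  proof -
    have "G_factor k \<alpha> \<beta> \<mu> \<delta> field_differentiable (at s)"
      using has_field_derivative_G_factor[of k \<alpha> \<mu> s \<beta> \<delta>] \<alpha> \<mu> that
      by (auto simp: field_differentiable_def)
    moreover have F: "partial_F a lam N field_differentiable (at z)" for z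
      using has_field_derivative_partial_F[OF lam] unfolding field_differentiable_def by blast
    have "((\<lambda>s. partial_F a lam N (of_real \<delta> - s)) has_field_derivative
        partial_F (\<lambda>n. - of_real (ln (lam n)) * a n) lam N (of_real \<delta> - s) * (0 - 1)) (at s)"
      by (rule DERIV_chain2[OF has_field_derivative_partial_F[OF lam]])
         (auto intro!: derivative_eq_intros)
    then have "(\<lambda>s. partial_F a lam N (of_real \<delta> - s)) field_differentiable (at s)"
      unfolding field_differentiable_def by blast
    ultimately show ?thesis
      unfolding zeta_N_def[abs_def] using F
      by (intro field_differentiable_add field_differentiable_mult)
  qed
  then show ?thesis by (auto simp: holomorphic_on_def field_differentiable_at_within)
qed

section \<open>Simplicity of the values on the critical line\<close>

lemma simple_value_if_G_log_deriv_nonzero: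
  assumes lam: "\<forall>n\<ge>1. lam n > 0" and \<alpha>: "\<forall>i\<in>{1..k}. \<alpha> i > 0" and \<mu>: "\<mu> > 0"
    and a: "\<forall>n\<ge>1. a n \<in> \<real>" and s: "Re s = \<delta> / 2" "Im s > 0"
    and c: "zeta_N a lam k \<alpha> \<beta> \<mu> \<delta> N s = c" "c \<noteq> 0"
    and L: "G_log_deriv k \<alpha> \<beta> \<mu> s \<noteq> 0"
  shows "simple_value (zeta_N a lam k \<alpha> \<beta> \<mu> \<delta> N) c s"
proof -
  define f where "f = partial_F a lam N"
  define f' where "f' = partial_F (\<lambda>n. - of_real (ln (lam n)) * a n) lam N"
  define G where "G = G_factor k \<alpha> \<beta> \<mu> \<delta>"
  define l where "l = complex_of_real (G_log_deriv k \<alpha> \<beta> \<mu> s)"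
  let ?z = "zeta_N a lam k \<alpha> \<beta> \<mu> \<delta> N"
  have zeta: "?z = (\<lambda>z. f z + G z * f (of_real \<delta> - z))"
    by (simp add: zeta_N_def[abs_def] f_def G_def)
  note refl_s = reflect_critical_line[OF s(1)]
  have f: "f (cnj s) = cnj (f s)" unfolding f_def using cnj_partial_F[OF lam a] by simp
  have f': "f' (cnj s) = cnj (f' s)" unfolding f'_def
    by (rule cnj_partial_F[OF lam, symmetric]) (use a in auto)
  have df: "(f has_field_derivative f' z) (at z)" for z
    unfolding f_def f'_def by (rule has_field_derivative_partial_F[OF lam])
  have dG: "(G has_field_derivative G s * l) (at s)"
    unfolding G_def l_def using has_field_derivative_G_factor_critical_line[of k \<alpha> \<mu> s \<delta> \<beta>] \<alpha> \<mu> s by simp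
  have GG: "G s * cnj (G s) = 1"
    unfolding G_def using G_factor_unimodular[of k \<alpha> \<mu> s \<delta> \<beta>] \<alpha> \<mu> s by simp
  define D where "D = f' s + G s * l * cnj (f s) - G s * cnj (f' s)"
  have "((\<lambda>z. f z + G z * f (of_real \<delta> - z)) has_field_derivative D) (at s)"
    unfolding D_def by (rule derivative_eq_intros df dG DERIV_chain2[OF df] refl)+
       (simp add: refl_s f f' algebra_simps)
  then have dz: "(?z has_field_derivative D) (at s)" by (simp add: zeta)
  have cs: "f s + G s * cnj (f s) = c" using c by (simp add: zeta refl_s f)
  have "D \<noteq> 0"
  proof
    assume "D = 0"
    \<comment> \<open>The terms with \<open>f' s\<close> cancel up to the factor
      \<open>G s * cnj (G s) - 1\<close>, which is 0. Realness of \<open>l\<close> enters through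
      \<open>cnj D\<close>.\<close>
    have "D + G s * cnj D = l * (f s + G s * cnj (f s)) + (G s * cnj (G s) - 1) * (l * f s - f' s)"
      by (simp add: D_def l_def algebra_simps)
    then have "l * c = 0" using \<open>D = 0\<close> GG cs by simp
    then show False using L c by (simp add: l_def)
  qed
  have "zorder (\<lambda>z. ?z z - c) s = 1"
  proof (rule zorder_zero_eqI)
    show "(\<lambda>z. ?z z - c) holomorphic_on {s. Im s > 0}"
      using zeta_N_holomorphic[of lam k \<alpha> \<mu>] lam \<alpha> \<mu> by (intro holomorphic_intros) auto
    show "open {s. Im s > 0}" by (rule open_halfspace_Im_gt)
    have "((\<lambda>z. ?z z - c) has_field_derivative D) (at s)"
      by (rule derivative_eq_intros dz refl)+ simp
    then show "(deriv ^^ nat 1) (\<lambda>z. ?z z - c) s \<noteq> 0" using \<open>D \<noteq> 0\<close> by (simp add: DERIV_imp_deriv)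
  qed (use s c in auto)
  then show ?thesis using c by (simp add: simple_value_def value_multiplicity_def)
qed

section \<open>Counting the values on the critical line\<close>

text \<open>The segment lies in the disc of radius \<open>U / 2\<close> about its midpoint, and the
  exponential sum has \<open>2 * N + 1\<close> terms. Distinct points are counted here;
  multiplicities are settled by simplicity.\<close>

lemma critical_values_card_le:
  fixes \<beta> :: "nat \<Rightarrow> real" and \<delta> :: real
  assumes lam: "\<forall>n\<ge>1. lam n > 0" "strict_mono_on {1..} lam" "lam 1 = 1"
    and \<alpha>: "\<forall>i\<in>{1..k}. \<alpha> i > 0" and \<mu>: "\<mu> > 0"
    and a: "\<forall>n\<ge>1. a n \<in> \<real>" "a 2 \<noteq> 0"
    and c: "c \<noteq> 0" and N: "N \<ge> 2" and T: "T > 0" and U: "U > 0"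
  defines "Z \<equiv> critical_values (zeta_N a lam k \<alpha> \<beta> \<mu> \<delta> N) \<delta> c T U"
  shows "finite Z \<and> real (card Z) \<le> 7 * (2 * real N + 1) + 7 * U * ln (lam N)"
proof -
  define \<omega> where "\<omega> = c / cnj c"
  \<comment> \<open>The disjoint sum keeps terms with equal exponents apart: exponent 0 occurs for
    \<open>n = 1\<close> in both polynomials and for the constant \<open>- c\<close>.\<close>
  define S :: "((nat + nat) + unit) set" where "S = ({1..N} <+> {1..N}) <+> {()}"
  define l where "l n = complex_of_real (ln (lam n))" for n
  define b where "b = case_sum (case_sum a (\<lambda>n. \<omega> * a n * exp (- l n * of_real \<delta>))) (\<lambda>_::unit. - c)"
  define w where "w = case_sum (case_sum (\<lambda>n. - l n) l) (\<lambda>_::unit. 0)"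
  have H: "(\<Sum>j\<in>S. b j * exp (w j * s)) = partial_F a lam N s + \<omega> * partial_F a lam N (of_real \<delta> - s) - c" for s
    unfolding S_def partial_F_conv_exp[OF lam(1)]
    by (subst sum.Plus, simp, simp, subst sum.Plus)
       (simp_all add: b_def w_def l_def o_def sum_distrib_left mult_ac ring_distribs flip: exp_add)
  have lt: "ln (lam m) < ln (lam n)" if "1 \<le> m" "m < n" for m n
    using that lam by (subst ln_less_cancel_iff) (auto simp: strict_mono_on_def)
  have nonneg: "0 \<le> ln (lam n)" if "1 \<le> n" for n
    using lt[of 1 n] lam(3) that by (cases "n = 1") auto
  have le: "ln (lam n) \<le> ln (lam N)" if "1 \<le> n" "n \<le> N" for n
    using lt[of n N] that by (cases "n = N") auto
  have "finite Z \<and> real (card Z) \<le> 7 * real (card S) + 14 * (U / 2) * ln (lam N)"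
  \<comment> \<open>The distinguished term is \<open>n = 2\<close> of the first polynomial: its
    coefficient \<open>a 2\<close> is nonzero and its exponent \<open>- ln (lam 2)\<close> is
    negative and occurs only once.\<close>
  proof (rule exponential_sum_zeros_card_le[where p = "Inl (Inl 2)" and b = b and w = w and ?s0.0 = "Complex (\<delta> / 2) (T + U / 2)"])
    show "finite S" "Inl (Inl 2) \<in> S" using N by (auto simp: S_def)
    show "b (Inl (Inl 2)) \<noteq> 0" using a by (simp add: b_def)
    show "U / 2 > 0" using U by simp
    fix j assume j: "j \<in> S"
    show "norm (w j) \<le> ln (lam N)"
      using j le nonneg N unfolding S_def w_def l_def by auto
    assume jp: "j \<noteq> Inl (Inl 2)"
    have 2: "ln (lam 2) > 0" using lt[of 1 2] lam(3) by simp
    have "n = 2" if "1 \<le> n" "ln (lam n) = ln (lam 2)" for n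
      using lt[of n 2] lt[of 2 n] that by (cases n "2 :: nat" rule: linorder_cases) auto
    moreover have "ln (lam n) \<noteq> - ln (lam 2)" if "1 \<le> n" for n
      using nonneg[OF that] 2 by linarith
    ultimately show "w j \<noteq> w (Inl (Inl 2))"
      using j jp 2 unfolding S_def w_def l_def by (auto simp flip: of_real_minus)
  next
    fix s assume "s \<in> Z"
    then have s: "Re s = \<delta> / 2" "T < Im s" "Im s < T + U" 
      and zc: "zeta_N a lam k \<alpha> \<beta> \<mu> \<delta> N s = c"
      by (auto simp: Z_def critical_values_def)
    have "s - Complex (\<delta> / 2) (T + U / 2) = \<i> * of_real (Im s - (T + U / 2))"
      using s by (simp add: complex_eq_iff)
    then have "dist s (Complex (\<delta> / 2) (T + U / 2)) = \<bar>Im s - (T + U / 2)\<bar>"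
      by (simp only: dist_norm norm_mult norm_ii norm_of_real mult_1)
    also have "\<dots> \<le> U / 2" unfolding abs_le_iff using s by (auto simp: field_simps)
    finally have d: "dist s (Complex (\<delta> / 2) (T + U / 2)) \<le> U / 2" .
    define G where "G = G_factor k \<alpha> \<beta> \<mu> \<delta> s"
    define f where "f = partial_F a lam N s"
    have GG: "G * cnj G = 1"
      unfolding G_def using G_factor_unimodular[of k \<alpha> \<mu> s \<delta> \<beta>] \<alpha> \<mu> s T by simp
    have fr: "partial_F a lam N (of_real \<delta> - s) = cnj f"
      unfolding reflect_critical_line[OF s(1)] f_def using cnj_partial_F[OF lam(1) a(1)] by simp
    have fc: "f + G * cnj f = c" using zc by (simp add: zeta_N_def fr G_def f_def)
    \<comment> \<open>Conjugating \<open>f + G * cnj f = c\<close> and multiplying by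
      \<open>G\<close> reproduces the left side, so \<open>G * cnj c = c\<close>.\<close>
    have "G * cnj c = G * cnj f + (G * cnj G) * f" unfolding fc[symmetric] by (simp add: algebra_simps)
    also have "\<dots> = c" using GG fc by (simp add: add.commute)
    finally have "\<omega> = G" using c by (simp add: \<omega>_def field_simps)
    then show "dist s (Complex (\<delta> / 2) (T + U / 2)) \<le> U / 2 \<and> (\<Sum>j\<in>S. b j * exp (w j * s)) = 0"
      using d fc by (simp add: H fr f_def)
  qed
  moreover have "card S = 2 * N + 1" by (simp add: S_def card_Plus)
  ultimately show ?thesis by simp
qed

section \<open>Growth of the frequencies and choice of the constants\<close>

lemma one_le_two_ln:
  assumes "N \<ge> 2"
  shows "1 \<le> 2 * ln (real N)"
proof -
  have "ln 2 \<le> ln (real N)" using assms by simp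
  then show ?thesis using ln2_ge_two_thirds by linarith
qed

text \<open>Polynomial growth handles large \<open>N\<close>, and monotonicity bounds the finitely
  many remaining frequencies by \<open>lam (n0 + 1)\<close>. Additive constants are absorbed through
  \<open>1 \<le> 2 * ln (real N)\<close>, which explains the factors 2 in \<open>B\<close>.\<close>

lemma ln_frequency_le:
  assumes mono: "strict_mono_on {1..} lam" and one: "lam 1 = 1"
    and growth: "lam \<in> O(\<lambda>n. real n powr A)"
  obtains B where "B \<ge> 0" "\<And>N. N \<ge> 2 \<Longrightarrow> ln (lam N) \<le> B * ln (real N)"
proof -
  have pos: "lam n \<ge> 1" if "n \<ge> 1" for n
    using frequency_ge_1[OF mono one that] .
  obtain K where K: "K > 0" "\<forall>\<^sub>F n in at_top. norm (lam n) \<le> K * norm (real n powr A)"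
    using landau_o.bigE[OF growth] by blast
  then obtain n0 where n0: "\<And>n. n \<ge> n0 \<Longrightarrow> norm (lam n) \<le> K * norm (real n powr A)"
    by (auto simp: eventually_at_top_linorder)
  define C where "C = ln (lam (n0 + 1))"
  have C: "C \<ge> 0" using pos[of "n0 + 1"] by (simp add: C_def)
  define B where "B = 2 * \<bar>ln K\<bar> + \<bar>A\<bar> + 2 * C"
  have "ln (lam N) \<le> B * ln (real N)" if N: "N \<ge> 2" for N
  proof -
    have "\<bar>A\<bar> * ln (real N) \<ge> A * ln (real N)" using N by (intro mult_right_mono) auto
    moreover have "\<bar>A\<bar> * ln (real N) \<ge> 0" using N by simp
    moreover have "\<bar>ln K\<bar> * 1 \<le> \<bar>ln K\<bar> * (2 * ln (real N))" using one_le_two_ln[OF N] by (intro mult_left_mono) auto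
    moreover have "C * 1 \<le> C * (2 * ln (real N))" using one_le_two_ln[OF N] C by (intro mult_left_mono) auto
    moreover have "ln (lam N) \<le> ln K + A * ln (real N) \<or> ln (lam N) \<le> C"
    proof (cases "N \<ge> n0")
      case True
      have "ln (lam N) \<le> ln (K * real N powr A)"
        using n0[OF True] pos[of N] N by (subst ln_le_cancel_iff) (auto intro: mult_pos_pos K)
      also have "\<dots> = ln K + A * ln (real N)" using N K by (simp add: ln_mult ln_powr)
      finally show ?thesis by simp
    next
      case False
      then have "lam N < lam (n0 + 1)" using mono N by (auto simp: strict_mono_on_def)
      then show ?thesis using pos[of N] N by (simp add: C_def)
    qed
    ultimately show ?thesis unfolding B_def using abs_ge_self[of "ln K"] C by (auto simp: algebra_simps)
  qed
  moreover have "B \<ge> 0" using C by (simp add: B_def)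
  ultimately show ?thesis using that by blast
qed

theorem theorem1p7:
  fixes a :: "nat \<Rightarrow> complex" and lam :: "nat \<Rightarrow> real" and k :: nat
    and \<alpha> \<beta> :: "nat \<Rightarrow> real" and \<mu> \<delta> :: real and F :: "complex \<Rightarrow> complex"
  assumes "dirichlet_with_functional_equation a lam k \<alpha> \<beta> \<mu> \<delta> F"
    and "\<forall>n\<ge>1. a n \<in> \<real>"
  shows "\<exists>T\<^sub>0 U\<^sub>0 \<nu> :: real. T\<^sub>0 > 0 \<and> U\<^sub>0 > 0 \<and> \<nu> > 0 \<and>
    (\<forall>N\<ge>2. \<forall>c::complex. c \<noteq> 0 \<longrightarrow>
       (\<forall>s. Re s = \<delta> / 2 \<and> Im s \<ge> T\<^sub>0 \<and> zeta_N a lam k \<alpha> \<beta> \<mu> \<delta> N s = c \<longrightarrow>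
          simple_value (zeta_N a lam k \<alpha> \<beta> \<mu> \<delta> N) c s)) \<and>
    (\<exists>C::real. \<forall>N\<ge>2. \<forall>c::complex. c \<noteq> 0 \<longrightarrow>
       (\<forall>T U. T \<ge> T\<^sub>0 \<and> U \<ge> U\<^sub>0 * real N powr \<nu> \<and>
          zeta_N a lam k \<alpha> \<beta> \<mu> \<delta> N (Complex (\<delta> / 2) T) \<noteq> c \<and>
          zeta_N a lam k \<alpha> \<beta> \<mu> \<delta> N (Complex (\<delta> / 2) (T + U)) \<noteq> c \<longrightarrow>
          finite (critical_values (zeta_N a lam k \<alpha> \<beta> \<mu> \<delta> N) \<delta> c T U) \<and>
          real (critical_value_count (zeta_N a lam k \<alpha> \<beta> \<mu> \<delta> N) \<delta> c T U) \<le> C * (U * ln (real N))))"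
proof -
  from assms(1) obtain A where
    mono: "strict_mono_on {1..} lam" and one: "lam 1 = 1" and a2: "a 2 \<noteq> 0"
    and growth: "lam \<in> O(\<lambda>n. real n powr A)" and k: "k \<ge> 1"
    and \<alpha>: "\<forall>i\<in>{1..k}. \<alpha> i > 0" and \<mu>: "\<mu> > 0"
    unfolding dirichlet_with_functional_equation_def by blast
  have lam: "\<forall>n\<ge>1. lam n > 0"
    using frequency_ge_1[OF mono one] by force
  obtain B where B: "B \<ge> 0" "\<And>N. N \<ge> 2 \<Longrightarrow> ln (lam N) \<le> B * ln (real N)"
    using ln_frequency_le[OF mono one growth] by blast
  obtain t0 where t0: "\<And>t. t \<ge> t0 \<Longrightarrow> G_log_deriv k \<alpha> \<beta> \<mu> (Complex (\<delta> / 2) t) < 0"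
    using G_log_deriv_eventually_negative[OF k \<alpha>, of \<beta> \<mu> \<delta>]
    unfolding eventually_at_top_linorder by blast
  \<comment> \<open>The maximum with 1 keeps the points in the upper half-plane, where
    \<open>zeta_N\<close> is holomorphic.\<close>
  define T0 where "T0 = max 1 t0"
  let ?z = "\<lambda>N. zeta_N a lam k \<alpha> \<beta> \<mu> \<delta> N"
  have simple: "simple_value (?z N) c s"
    if "c \<noteq> 0" "Re s = \<delta> / 2" "Im s \<ge> T0" "?z N s = c" for N c s
  proof (rule simple_value_if_G_log_deriv_nonzero[OF lam \<alpha> \<mu> assms(2)])
    have "s = Complex (\<delta> / 2) (Im s)" using that by (simp add: complex_eq_iff)
    then show "G_log_deriv k \<alpha> \<beta> \<mu> s \<noteq> 0" using t0[of "Im s"] that by (simp add: T0_def)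
  qed (use that in \<open>auto simp: T0_def\<close>)
  \<comment> \<open>Here \<open>U \<ge> N\<close>, so \<open>7 * (2 * N + 1)\<close> is at most
    \<open>21 * U\<close>; multiplying by \<open>2 * ln (real N)\<close> gives the 42. The part
    \<open>7 * B\<close> comes from the bound on \<open>ln (lam N)\<close>, and neither constant
    depends on \<open>c\<close>.\<close>
  have count: "finite (critical_values (?z N) \<delta> c T U) \<and>
      real (critical_value_count (?z N) \<delta> c T U) \<le> (42 + 7 * B) * (U * ln (real N))"
    if N: "N \<ge> 2" and c: "c \<noteq> 0" and T: "T \<ge> T0" and U: "U \<ge> 1 * real N powr 1" for N c T U
  proof -
    have UN: "real N \<le> U" "U \<ge> 2" using N U by auto
    let ?Z = "critical_values (?z N) \<delta> c T U"
    have Z: "finite ?Z" "real (card ?Z) \<le> 7 * (2 * real N + 1) + 7 * U * ln (lam N)"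
      using critical_values_card_le[OF lam mono one \<alpha> \<mu> assms(2) a2 c N, of T U] T UN
      by (auto simp: T0_def)
    \<comment> \<open>By simplicity every multiplicity is 1, so the weighted count is the
      cardinality.\<close>
    have "critical_value_count (?z N) \<delta> c T U = (\<Sum>s\<in>?Z. 1)"
      unfolding critical_value_count_def
      using simple[OF c, of _ N] T by (intro sum.cong) (auto simp: critical_values_def simple_value_def)
    then have "real (critical_value_count (?z N) \<delta> c T U) \<le> 21 * U + 7 * U * ln (lam N)"
      using Z(2) UN by simp
    also have "7 * U * ln (lam N) \<le> 7 * U * (B * ln (real N))"
      using B(2)[OF N] UN by (intro mult_left_mono) auto
    also have "21 * U \<le> 42 * U * ln (real N)"
    proof -
      have "21 * U * 1 \<le> 21 * U * (2 * ln (real N))"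
        using UN one_le_two_ln[OF N] by (intro mult_left_mono) auto
      then show ?thesis by simp
    qed
    finally show ?thesis using Z(1) by (simp add: algebra_simps)
  qed
  show ?thesis
  proof (intro exI conjI)
    show "T0 > 0" "(1::real) > 0" "(1::real) > 0" by (auto simp: T0_def)
    show "\<forall>N\<ge>2. \<forall>c. c \<noteq> 0 \<longrightarrow> (\<forall>s. Re s = \<delta> / 2 \<and> Im s \<ge> T0 \<and> ?z N s = c \<longrightarrow> simple_value (?z N) c s)"
      using simple by blast
    show "\<forall>N\<ge>2. \<forall>c. c \<noteq> 0 \<longrightarrow> (\<forall>T U. T \<ge> T0 \<and> U \<ge> 1 * real N powr 1 \<and>
          ?z N (Complex (\<delta> / 2) T) \<noteq> c \<and> ?z N (Complex (\<delta> / 2) (T + U)) \<noteq> c \<longrightarrow>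
          finite (critical_values (?z N) \<delta> c T U) \<and>
          real (critical_value_count (?z N) \<delta> c T U) \<le> (42 + 7 * B) * (U * ln (real N)))"
      using count by blast
  qed
qed

end
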